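(* Let $u=(u_1,u_2)$ with $u_i\in\mathbb{X}(\overline{\Omega}_i)$, $i=1,2$, be the classical solution of the elliptic interface problem $$-\nabla\cdot(\beta\nabla u)=f \text{ in }\Omega_1\cup\Omega_2,\quad \llbracket u\rrbracket=g_1 \text{ on }\Gamma,\quad \llbracket\beta\nabla u\cdot\boldsymbol{n}\rrbracket=g_2\text{ on }\Gamma,\quad u=g_D\text{ on }\partial\Omega,$$ and let $u_{\boldsymbol{\theta}_i}^{*}:=u_{\boldsymbol{\theta}_i^*}\in\mathbb{X}(\overline{\Omega}_i)$, $i=1,2$, be the numerical approximations given by the two neural networks with parameters $\boldsymbol{\theta}_1^*,\boldsymbol{\theta}_2^*$. Assume the following. (A1) (Conditional stability) There are exponents $0<\beta_{\mathcal{L}_i},\beta_{\mathcal{B}_i},\beta_{\Gamma}\le 1$ $(i=1,2)$ such that for all sufficiently regular $v=(v_1,v_2)$, $v_i\in\mathbb{X}(\overline{\Omega}_i)$ (in particular for $v_i=u_{\boldsymbol{\theta}_i}^*$), $$\begin{aligned}\sum_{i=1}^2\|u_i-v_i\|_{\mathbb{X}(\overline{\Omega}_i)}^2\le C_{pde}\Big\{&\sum_{i=1}^2\Big[\big(\|\nabla\cdot(\beta\nabla u_i)-\nabla\cdot(\beta\nabla v_i)\|_{L^2(\Omega_i)}^2\big)^{\beta_{\mathcal{L}_i}}+\big(\|u_i-v_i\|_{L^2(\partial\Omega_i\setminus\Gamma)}^2\big)^{\beta_{\mathcal{B}_i}}\Big]\\&+\big(\|\llbracket u\rrbracket-\llbracket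 v\rrbracket\|_{L^2(\Gamma)}^2\big)^{\beta_\Gamma}+\big(\|\llbracket\beta\nabla u\cdot\boldsymbol{n}\rrbracket-\llbracket\beta\nabla v\cdot\boldsymbol{n}\rrbracket\|_{L^2(\Gamma)}^2\big)^{\beta_\Gamma}\Big\},\end{aligned}$$ where $C_{pde}>0$ depends on $\|u_i\|_{\mathbb{X}(\overline{\Omega}_i)}$, $\|v_i\|_{\mathbb{X}(\overline{\Omega}_i)}$, $\beta$, the geometry of the domains, and the regularity of the problem. (A2) (Quadrature error) For each of the discrete losses $\mathcal{F}_{\mathcal{L}_i},\mathcal{F}_{\mathcal{B}_i},\mathcal{F}_{\mathcal{I}_1},\mathcal{F}_{\mathcal{I}_2}$, viewed as a quadrature rule for the integral of the corresponding squared residual of $(u_{\boldsymbol{\theta}_1}^*,u_{\boldsymbol{\theta}_2}^* )$ over $\Omega_i$, $\partial\Omega_i\setminus\Gamma$, $\Gamma$, $\Gamma$ respectively, the absolute quadrature error is at most $\tilde C\,N^{-\alpha}$, where $N$ is the number of points ($M_i$, $M_{\mathcal{B}_i}$, $M_\Gamma$, $M_\Gamma$ respectively), $\alpha>0$ is a rate ($\alpha_{\mathcal{L}_i},\alpha_{\mathcal{B}_i},\alpha_{\mathcal{I}_1},\alpha_{\mathcal{I}_2}$ respectively), and $\tilde C>0$ is a constant ($\tilde C^{\mathcal{L}_i},\tilde C^{\mathcal{B}_i},\tilde C^{\mathcal{I}_1},\tilde C^{\mathcal{I}_2}$ respectively). Then there are positive constants $C_{quad}^{\mathcal{L}_i},C_{quad}^{\mathcal{B}_i},C_{quad}^{\mathcal{I}_1},C_{quad}^{\mathcal{I}_2}$,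 depending only on the corresponding constants $\tilde C$ and on the stability exponents, such that $$\begin{aligned}\sum_{i=1}^2\|u_i-u_{\boldsymbol{\theta}_i}^*\|_{\mathbb{X}(\overline{\Omega}_i)}^2\le C_{pde}\Big\{&\sum_{i=1}^2\big[(\mathcal{F}_{\mathcal{L}_i}(\boldsymbol{\theta}_i^* ))^{\beta_{\mathcal{L}_i}}+(\mathcal{F}_{\mathcal{B}_i}(\boldsymbol{\theta}_i^* ))^{\beta_{\mathcal{B}_i}}\big]+(\mathcal{F}_{\mathcal{I}_1}(\boldsymbol{\theta}_1^*,\boldsymbol{\theta}_2^* ))^{\beta_\Gamma}+(\mathcal{F}_{\mathcal{I}_2}(\boldsymbol{\theta}_1^*,\boldsymbol{\theta}_2^* ))^{\beta_\Gamma}\\&+\sum_{i=1}^2\big(C_{quad}^{\mathcal{L}_i}M_i^{-\alpha_{\mathcal{L}_i}\beta_{\mathcal{L}_i}}+C_{quad}^{\mathcal{B}_i}M_{\mathcal{B}_i}^{-\alpha_{\mathcal{B}_i}\beta_{\mathcal{B}_i}}\big)+C_{quad}^{\mathcal{I}_1}M_\Gamma^{-\alpha_{\mathcal{I}_1}\beta_\Gamma}+C_{quad}^{\mathcal{I}_2}M_\Gamma^{-\alpha_{\mathcal{I}_2}\beta_\Gamma}\Big\},\end{aligned}$$ where $C_{pde}$ is the positive constant of (A1) for $v_i=u_{\boldsymbol{\theta}_i}^*$, depending on $\|u_i\|_{\mathbb{X}(\overline{\Omega}_i)}$, $\|u_{\boldsymbol{\theta}_i}^*\|_{\mathbb{X}(\overline{\Omega}_i)}$,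 $\beta$ and the domains $\Omega_i$.
   Context: Setting. $\Omega\subset\mathbb{R}^d$, $d\ge2$, is a bounded open domain with Lipschitz boundary; $\Gamma$ is a Lipschitz interface partitioning $\Omega$ into two disjoint open subdomains $\Omega_1,\Omega_2$; $\boldsymbol{n}$ is the unit normal on $\Gamma$ pointing from $\Omega_1$ to $\Omega_2$. The coefficient $\beta\ge\beta_0>0$ is piecewise constant, $\beta=\beta_i$ in $\Omega_i$. For $w=(w_1,w_2)$ with $w_i$ defined on $\overline{\Omega}_i$, $\llbracket w\rrbracket=w_1|_\Gamma-w_2|_\Gamma$ and $\llbracket\beta\nabla w\cdot\boldsymbol{n}\rrbracket=\beta_1\nabla w_1\cdot\boldsymbol{n}-\beta_2\nabla w_2\cdot\boldsymbol{n}$ on $\Gamma$. The data are $f\in L^2(\Omega)$, $g_D\in H^{1/2}(\partial\Omega)$, and $g_1,g_2$ on $\Gamma$. Function space. $\mathbb{X}(\overline{\Omega}_i)=C^2(\overline{\Omega}_i)$ for classical solutions, or more generally $\mathbb{X}(\overline{\Omega}_i)=H^s(\Omega_i)$ with suitable $s\ge2$, with its norm. Networks. For $i=1,2$, $u_{\boldsymbol{\theta}_i}:\mathbb{R}^d\to\mathbb{R}$ is a feed-forward neural network with parameter vector (weights and biases) $\boldsymbol{\theta}_i\in\mathbb{R}^M$; the two networks have the same architecture and independent parameters. $(\boldsymbol{\theta}_1^*,\boldsymbol{\theta}_2^* )$ denotes the parameters obtained by minimizing a positively weighted sum of the discrete losses below. Discrete losses. With sample points $\boldsymbol{x}_k$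 in $\Omega_i$ ($M_i$ points), on $\partial\Omega_i\setminus\Gamma$ ($M_{\mathcal{B}_i}$ points) and on $\Gamma$ ($M_\Gamma$ points): $$\mathcal{F}_{\mathcal{L}_i}(\boldsymbol{\theta}_i)=\frac1{M_i}\sum_{k=1}^{M_i}|-\nabla\cdot(\beta_i\nabla u_{\boldsymbol{\theta}_i})(\boldsymbol{x}_k)-f(\boldsymbol{x}_k)|^2,\qquad \mathcal{F}_{\mathcal{B}_i}(\boldsymbol{\theta}_i)=\frac1{M_{\mathcal{B}_i}}\sum_{k=1}^{M_{\mathcal{B}_i}}|u_{\boldsymbol{\theta}_i}(\boldsymbol{x}_k)-g_D(\boldsymbol{x}_k)|^2,$$ $$\mathcal{F}_{\mathcal{I}_1}(\boldsymbol{\theta}_1,\boldsymbol{\theta}_2)=\frac1{M_\Gamma}\sum_{k=1}^{M_\Gamma}|u_{\boldsymbol{\theta}_1}(\boldsymbol{x}_k)-u_{\boldsymbol{\theta}_2}(\boldsymbol{x}_k)-g_1(\boldsymbol{x}_k)|^2,$$ $$\mathcal{F}_{\mathcal{I}_2}(\boldsymbol{\theta}_1,\boldsymbol{\theta}_2)=\frac1{M_\Gamma}\sum_{k=1}^{M_\Gamma}|\beta_1\nabla u_{\boldsymbol{\theta}_1}(\boldsymbol{x}_k)\cdot\boldsymbol{n}-\beta_2\nabla u_{\boldsymbol{\theta}_2}(\boldsymbol{x}_k)\cdot\boldsymbol{n}-g_2(\boldsymbol{x}_k)|^2.$$ If one of the numbers of points is $0$ (e.g. when $\partial\Omega_i\setminus\Gamma$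 is empty), the corresponding term is dropped. The squared residuals integrated in (A2) are: $|-\nabla\cdot(\beta_i\nabla u_{\boldsymbol{\theta}_i}^* )-f|^2$ over $\Omega_i$; $|u_{\boldsymbol{\theta}_i}^*-g_D|^2$ over $\partial\Omega_i\setminus\Gamma$; $|u_{\boldsymbol{\theta}_1}^*-u_{\boldsymbol{\theta}_2}^*-g_1|^2$ over $\Gamma$; $|\beta_1\nabla u_{\boldsymbol{\theta}_1}^*\cdot\boldsymbol{n}-\beta_2\nabla u_{\boldsymbol{\theta}_2}^*\cdot\boldsymbol{n}-g_2|^2$ over $\Gamma$. *)

theory Defs
  imports "HOL-Analysis.Analysis" "HOL-Library.Multiset"
begin

section \<open>Lebesgue and surface measure, square integrability\<close>

text \<open>
  The surface measure is the \<open>(d - 1)\<close>-dimensional Hausdorff measure, normalised so that it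
  agrees with Lebesgue measure on hyperplanes, and completed.  The coverings have to consist of
  bounded sets because \<^const>\<open>diameter\<close> takes an arbitrary value on unbounded ones.
\<close>

definition hausdorff_pre :: "real \<Rightarrow> real \<Rightarrow> 'a::metric_space set \<Rightarrow> ennreal" where
  "hausdorff_pre k \<delta> A =
     Inf {(\<Sum>j. ennreal (unit_ball_vol k * (diameter (E j) / 2) powr k)) | E :: nat \<Rightarrow> 'a set.
            A \<subseteq> (\<Union>j. E j) \<and> (\<forall>j. bounded (E j) \<and> diameter (E j) \<le> \<delta>)}"

definition hausdorff_outer :: "real \<Rightarrow> 'a::metric_space set \<Rightarrow> ennreal" where
  "hausdorff_outer k A = (SUP \<delta>\<in>{0<..}. hausdorff_pre k \<delta> A)"

definition surface :: "(real ^ 'd) measure" where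
  "surface = completion (measure_of UNIV (sets borel) (hausdorff_outer (real CARD('d) - 1)))"

abbreviation surface_on :: "(real ^ 'd) set \<Rightarrow> (real ^ 'd) measure" where
  "surface_on S \<equiv> restrict_space surface S"

definition L2_fun :: "'a measure \<Rightarrow> ('a \<Rightarrow> real) \<Rightarrow> bool" where
  "L2_fun M h \<longleftrightarrow> h \<in> borel_measurable M \<and> integrable M (\<lambda>x. (h x)\<^sup>2)"

definition L2_norm :: "'a measure \<Rightarrow> ('a \<Rightarrow> real) \<Rightarrow> real" where
  "L2_norm M h = sqrt (LINT x|M. (h x)\<^sup>2)"

text \<open>
  Square of the Sobolev--Slobodeckij (Gagliardo) seminorm of order \<open>\<sigma>\<close> on a set of dimension
  \<open>k\<close> with measure \<open>M\<close>.
\<close>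

definition slobodeckij :: "(real ^ 'd) measure \<Rightarrow> real \<Rightarrow> real \<Rightarrow> (real ^ 'd \<Rightarrow> real) \<Rightarrow> ennreal" where
  "slobodeckij M k \<sigma> h =
     (\<integral>\<^sup>+x. (\<integral>\<^sup>+y. ennreal ((h x - h y)\<^sup>2 / dist x y powr (k + 2 * \<sigma>)) \<partial>M) \<partial>M)"

definition H_half :: "(real ^ 'd) set \<Rightarrow> (real ^ 'd \<Rightarrow> real) \<Rightarrow> bool" where
  "H_half S g \<longleftrightarrow>
     L2_fun (surface_on S) g \<and> slobodeckij (surface_on S) (real CARD('d) - 1) (1/2) g < \<infinity>"


section \<open>Classical and weak derivatives\<close>

definition pd :: "'d \<Rightarrow> (real ^ 'd \<Rightarrow> real) \<Rightarrow> real ^ 'd \<Rightarrow> real" where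
  "pd i w x = frechet_derivative w (at x) (axis i 1)"

fun pds :: "'d list \<Rightarrow> (real ^ 'd \<Rightarrow> real) \<Rightarrow> real ^ 'd \<Rightarrow> real" where
  "pds [] w = w"
| "pds (i # is) w = pd i (pds is w)"

definition grad :: "(real ^ 'd \<Rightarrow> real) \<Rightarrow> real ^ 'd \<Rightarrow> real ^ 'd" where
  "grad w x = (\<chi> i. pd i w x)"

definition divergence :: "(real ^ 'd \<Rightarrow> real ^ 'd) \<Rightarrow> real ^ 'd \<Rightarrow> real" where
  "divergence F x = (\<Sum>i\<in>UNIV. pd i (\<lambda>y. F y $ i) x)"

definition test_fun :: "(real ^ 'd) set \<Rightarrow> (real ^ 'd \<Rightarrow> real) \<Rightarrow> bool" where
  "test_fun U \<phi> \<longleftrightarrow> (\<forall>is. pds is \<phi> differentiable_on UNIV) \<and>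
     compact (closure {x. \<phi> x \<noteq> 0}) \<and> closure {x. \<phi> x \<noteq> 0} \<subseteq> U"

definition loc_integrable :: "(real ^ 'd) set \<Rightarrow> (real ^ 'd \<Rightarrow> real) \<Rightarrow> bool" where
  "loc_integrable U g \<longleftrightarrow> (\<forall>K. compact K \<and> K \<subseteq> U \<longrightarrow> integrable (lebesgue_on K) g)"

text \<open>
  A multi-index is a multiset \<open>\<alpha>\<close> of coordinate directions, of order \<^term>\<open>size \<alpha>\<close>.
  The weak derivative and the weak divergence are unique up to null sets; below they only enter
  through integrals and almost-everywhere statements.
\<close>

definition is_weak_deriv ::
  "(real ^ 'd) set \<Rightarrow> 'd multiset \<Rightarrow> (real ^ 'd \<Rightarrow> real) \<Rightarrow> (real ^ 'd \<Rightarrow> real) \<Rightarrow> bool" where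
  "is_weak_deriv U \<alpha> w g \<longleftrightarrow> loc_integrable U g \<and>
     (\<forall>\<phi> is. test_fun U \<phi> \<and> mset is = \<alpha> \<longrightarrow>
        (LINT x|lebesgue_on U. w x * pds is \<phi> x) =
        (- 1) ^ size \<alpha> * (LINT x|lebesgue_on U. g x * \<phi> x))"

definition wderiv ::
  "(real ^ 'd) set \<Rightarrow> 'd multiset \<Rightarrow> (real ^ 'd \<Rightarrow> real) \<Rightarrow> real ^ 'd \<Rightarrow> real" where
  "wderiv U \<alpha> w = (SOME g. is_weak_deriv U \<alpha> w g)"

definition wgrad :: "(real ^ 'd) set \<Rightarrow> (real ^ 'd \<Rightarrow> real) \<Rightarrow> real ^ 'd \<Rightarrow> real ^ 'd" where
  "wgrad U w x = (\<chi> i. wderiv U {#i#} w x)"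

definition wdiv :: "(real ^ 'd) set \<Rightarrow> (real ^ 'd \<Rightarrow> real ^ 'd) \<Rightarrow> real ^ 'd \<Rightarrow> real" where
  "wdiv U F = (SOME g. loc_integrable U g \<and>
     (\<forall>\<phi>. test_fun U \<phi> \<longrightarrow>
        (LINT x|lebesgue_on U. F x \<bullet> grad \<phi> x) = - (LINT x|lebesgue_on U. g x * \<phi> x)))"

text \<open>
  The trace, evaluated pointwise: at almost every boundary point near which \<open>U\<close> is a Lipschitz
  domain, the trace of a Sobolev function is the limit of its averages over small half-balls.
\<close>

definition trace :: "(real ^ 'd) set \<Rightarrow> (real ^ 'd \<Rightarrow> 'b::euclidean_space) \<Rightarrow> real ^ 'd \<Rightarrow> 'b" where
  "trace U w x = Lim (at_right 0)
     (\<lambda>r. (LINT y|lebesgue_on (U \<inter> ball x r). w y) /\<^sub>R measure lebesgue (U \<inter> ball x r))"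


section \<open>The spaces \<open>C\<^sup>2\<close> on the closure and \<open>H\<^sup>s\<close>\<close>

datatype space = C2 | Sob real

fun admissible_space :: "space \<Rightarrow> bool" where
  "admissible_space C2 \<longleftrightarrow> True"
| "admissible_space (Sob s) \<longleftrightarrow> 2 \<le> s"

definition in_C2 :: "(real ^ 'd) set \<Rightarrow> (real ^ 'd \<Rightarrow> real) \<Rightarrow> bool" where
  "in_C2 U w \<longleftrightarrow> continuous_on (closure U) w \<and>
     (\<forall>is. length is < 2 \<longrightarrow> pds is w differentiable_on U) \<and>
     (\<forall>is. length is \<le> 2 \<longrightarrow>
        (\<exists>h. continuous_on (closure U) h \<and> (\<forall>x\<in>U. h x = pds is w x)))"

definition C2_norm :: "(real ^ 'd) set \<Rightarrow> (real ^ 'd \<Rightarrow> real) \<Rightarrow> real" where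
  "C2_norm U w = Sup {\<bar>pds is w x\<bar> | is x. length is \<le> 2 \<and> x \<in> U}"

text \<open>For \<open>s = m + \<sigma>\<close> with \<open>m\<close> the integer part: weak derivatives up to order \<open>m\<close> in \<open>L\<^sup>2\<close> and, if
  \<open>\<sigma> > 0\<close>, finite seminorms of order \<open>\<sigma>\<close> of the derivatives of order \<open>m\<close>.\<close>

definition in_Sob :: "real \<Rightarrow> (real ^ 'd) set \<Rightarrow> (real ^ 'd \<Rightarrow> real) \<Rightarrow> bool" where
  "in_Sob s U w \<longleftrightarrow> L2_fun (lebesgue_on U) w \<and>
     (\<forall>\<alpha>. size \<alpha> \<le> nat \<lfloor>s\<rfloor> \<longrightarrow>
        (\<exists>g. is_weak_deriv U \<alpha> w g) \<and> L2_fun (lebesgue_on U) (wderiv U \<alpha> w)) \<and>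
     (0 < frac s \<longrightarrow>
        (\<forall>\<alpha>. size \<alpha> = nat \<lfloor>s\<rfloor> \<longrightarrow>
           slobodeckij (lebesgue_on U) (real CARD('d)) (frac s) (wderiv U \<alpha> w) < \<infinity>))"

definition Sob_norm :: "real \<Rightarrow> (real ^ 'd) set \<Rightarrow> (real ^ 'd \<Rightarrow> real) \<Rightarrow> real" where
  "Sob_norm s U w = sqrt (
     (\<Sum>\<alpha> | size \<alpha> \<le> nat \<lfloor>s\<rfloor>. (L2_norm (lebesgue_on U) (wderiv U \<alpha> w))\<^sup>2) +
     (if 0 < frac s
      then (\<Sum>\<alpha> | size \<alpha> = nat \<lfloor>s\<rfloor>.
              enn2real (slobodeckij (lebesgue_on U) (real CARD('d)) (frac s) (wderiv U \<alpha> w)))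
      else 0))"

fun in_space :: "space \<Rightarrow> (real ^ 'd) set \<Rightarrow> (real ^ 'd \<Rightarrow> real) \<Rightarrow> bool" where
  "in_space C2 U w = in_C2 U w"
| "in_space (Sob s) U w = in_Sob s U w"

fun space_norm :: "space \<Rightarrow> (real ^ 'd) set \<Rightarrow> (real ^ 'd \<Rightarrow> real) \<Rightarrow> real" where
  "space_norm C2 U w = C2_norm U w"
| "space_norm (Sob s) U w = Sob_norm s U w"

text \<open>The gradient up to the boundary, as continuous extension from \<open>U\<close>: the only meaning that
  the gradient of a function on the closure of \<open>U\<close> has at points of an interface.\<close>

definition grad_ext :: "(real ^ 'd) set \<Rightarrow> (real ^ 'd \<Rightarrow> real) \<Rightarrow> real ^ 'd \<Rightarrow> real ^ 'd" where
  "grad_ext U w x = Lim (at x within U) (grad w)"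

text \<open>\<open>\<nabla> \<cdot> (b \<nabla>w)\<close> in \<open>U\<close>, and the values of \<open>w\<close> and \<open>\<nabla>w\<close> on the boundary of \<open>U\<close>: classical for
  \<^const>\<open>C2\<close>, weak derivatives and traces for \<^const>\<open>Sob\<close>.\<close>

fun div_grad :: "space \<Rightarrow> (real ^ 'd) set \<Rightarrow> real \<Rightarrow> (real ^ 'd \<Rightarrow> real) \<Rightarrow> real ^ 'd \<Rightarrow> real" where
  "div_grad C2 U b w = divergence (\<lambda>y. b *\<^sub>R grad w y)"
| "div_grad (Sob s) U b w = wdiv U (\<lambda>y. b *\<^sub>R wgrad U w y)"

fun bd_value :: "space \<Rightarrow> (real ^ 'd) set \<Rightarrow> (real ^ 'd \<Rightarrow> real) \<Rightarrow> real ^ 'd \<Rightarrow> real" where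
  "bd_value C2 U w = w"
| "bd_value (Sob s) U w = trace U w"

fun bd_grad :: "space \<Rightarrow> (real ^ 'd) set \<Rightarrow> (real ^ 'd \<Rightarrow> real) \<Rightarrow> real ^ 'd \<Rightarrow> real ^ 'd" where
  "bd_grad C2 U w = grad_ext U w"
| "bd_grad (Sob s) U w = trace U (wgrad U w)"


section \<open>The interface problem\<close>

datatype side = Side1 | Side2

record 'd interface_problem =
  dom :: "(real ^ 'd) set"
  sub :: "side \<Rightarrow> (real ^ 'd) set"
  intf :: "(real ^ 'd) set"
  nrm :: "real ^ 'd \<Rightarrow> real ^ 'd"
  coef :: "side \<Rightarrow> real"
  src :: "real ^ 'd \<Rightarrow> real"
  dir :: "real ^ 'd \<Rightarrow> real"
  jmp1 :: "real ^ 'd \<Rightarrow> real"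
  jmp2 :: "real ^ 'd \<Rightarrow> real"

text \<open>Signed height of \<open>y\<close> in direction \<open>e\<close> over the graph of \<open>\<gamma>\<close>, a function on the hyperplane
  orthogonal to the unit vector \<open>e\<close>.\<close>

definition height :: "real ^ 'd \<Rightarrow> (real ^ 'd \<Rightarrow> real) \<Rightarrow> real ^ 'd \<Rightarrow> real" where
  "height e \<gamma> y = y \<bullet> e - \<gamma> (y - (y \<bullet> e) *\<^sub>R e)"

definition lipschitz_boundary :: "(real ^ 'd) set \<Rightarrow> bool" where
  "lipschitz_boundary U \<longleftrightarrow>
     (\<forall>x\<in>frontier U. \<exists>e r L \<gamma>. norm e = 1 \<and> 0 < r \<and> L-lipschitz_on UNIV \<gamma> \<and>
        U \<inter> ball x r = {y \<in> ball x r. 0 < height e \<gamma> y})"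

definition lipschitz_interface ::
  "(real ^ 'd) set \<Rightarrow> (real ^ 'd) set \<Rightarrow> (real ^ 'd) set \<Rightarrow> bool" where
  "lipschitz_interface G U1 U2 \<longleftrightarrow>
     (\<forall>x\<in>G. \<exists>e r L \<gamma>. norm e = 1 \<and> 0 < r \<and> L-lipschitz_on UNIV \<gamma> \<and>
        U1 \<inter> ball x r = {y \<in> ball x r. height e \<gamma> y < 0} \<and>
        G \<inter> ball x r = {y \<in> ball x r. height e \<gamma> y = 0} \<and>
        U2 \<inter> ball x r = {y \<in> ball x r. 0 < height e \<gamma> y})"

text \<open>\<open>\<nu>\<close> is the unit normal at \<open>x\<close> pointing from \<open>U1\<close> to \<open>U2\<close>: for every opening angle, close to
  \<open>x\<close> the cone around \<open>- \<nu>\<close> lies in \<open>U1\<close> and the one around \<open>\<nu>\<close> in \<open>U2\<close>.  On a Lipschitz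
  interface this determines \<open>\<nu>\<close> at almost every point.\<close>

definition unit_normal_at ::
  "(real ^ 'd) set \<Rightarrow> (real ^ 'd) set \<Rightarrow> real ^ 'd \<Rightarrow> real ^ 'd \<Rightarrow> bool" where
  "unit_normal_at U1 U2 x \<nu> \<longleftrightarrow> norm \<nu> = 1 \<and>
     (\<forall>\<epsilon>>0. \<exists>r>0. \<forall>y\<in>ball x r.
        (\<nu> \<bullet> (y - x) < - \<epsilon> * dist x y \<longrightarrow> y \<in> U1) \<and>
        (\<nu> \<bullet> (y - x) > \<epsilon> * dist x y \<longrightarrow> y \<in> U2))"

definition setting :: "'d::finite interface_problem \<Rightarrow> bool" where
  "setting P \<longleftrightarrow>
     2 \<le> CARD('d) \<and>
     open (dom P) \<and> connected (dom P) \<and> bounded (dom P) \<and> lipschitz_boundary (dom P) \<and>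
     (\<forall>i. open (sub P i) \<and> sub P i \<noteq> {}) \<and>
     sub P Side1 \<inter> sub P Side2 = {} \<and>
     intf P \<subseteq> dom P \<and> dom P - intf P = sub P Side1 \<union> sub P Side2 \<and>
     lipschitz_interface (intf P) (sub P Side1) (sub P Side2) \<and>
     (AE x in surface_on (intf P). unit_normal_at (sub P Side1) (sub P Side2) x (nrm P x)) \<and>
     (\<exists>\<beta>0>0. \<forall>i. \<beta>0 \<le> coef P i) \<and>
     L2_fun (lebesgue_on (dom P)) (src P) \<and>
     H_half (frontier (dom P)) (dir P)"

text \<open>A pair \<open>w = (w\<^sub>1, w\<^sub>2)\<close> is a function on \<^typ>\<open>side\<close>; only \<open>w\<^sub>i\<close> on the closure of
  \<open>sub P i\<close> matters.\<close>

definition jump ::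
  "space \<Rightarrow> 'd::finite interface_problem \<Rightarrow> (side \<Rightarrow> real ^ 'd \<Rightarrow> real) \<Rightarrow> real ^ 'd \<Rightarrow> real" where
  "jump X P w x = bd_value X (sub P Side1) (w Side1) x - bd_value X (sub P Side2) (w Side2) x"

definition flux_jump ::
  "space \<Rightarrow> 'd::finite interface_problem \<Rightarrow> (side \<Rightarrow> real ^ 'd \<Rightarrow> real) \<Rightarrow> real ^ 'd \<Rightarrow> real" where
  "flux_jump X P w x =
     coef P Side1 * (bd_grad X (sub P Side1) (w Side1) x \<bullet> nrm P x) -
     coef P Side2 * (bd_grad X (sub P Side2) (w Side2) x \<bullet> nrm P x)"

text \<open>The data are only determined up to null sets, so the equations hold almost everywhere.\<close>

definition is_solution ::
  "space \<Rightarrow> 'd::finite interface_problem \<Rightarrow> (side \<Rightarrow> real ^ 'd \<Rightarrow> real) \<Rightarrow> bool" where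
  "is_solution X P u \<longleftrightarrow>
     (\<forall>i. in_space X (sub P i) (u i)) \<and>
     (\<forall>i. AE x in lebesgue_on (sub P i). - div_grad X (sub P i) (coef P i) (u i) x = src P x) \<and>
     (AE x in surface_on (intf P). jump X P u x = jmp1 P x) \<and>
     (AE x in surface_on (intf P). flux_jump X P u x = jmp2 P x) \<and>
     (\<forall>i. AE x in surface_on (frontier (dom P) \<inter> frontier (sub P i)).
        bd_value X (sub P i) (u i) x = dir P x)"


section \<open>Conditional stability\<close>

record exponents =
  ex_L :: "side \<Rightarrow> real"
  ex_B :: "side \<Rightarrow> real"
  ex_G :: real

definition valid_exponents :: "exponents \<Rightarrow> bool" where
  "valid_exponents e \<longleftrightarrow>
     (\<forall>i. 0 < ex_L e i \<and> ex_L e i \<le> 1) \<and> (\<forall>i. 0 < ex_B e i \<and> ex_B e i \<le> 1) \<and>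
     0 < ex_G e \<and> ex_G e \<le> 1"

abbreviation outer_boundary :: "'d::finite interface_problem \<Rightarrow> side \<Rightarrow> (real ^ 'd) set" where
  "outer_boundary P i \<equiv> frontier (sub P i) - intf P"

definition norms ::
  "space \<Rightarrow> 'd::finite interface_problem \<Rightarrow> (side \<Rightarrow> real ^ 'd \<Rightarrow> real) \<Rightarrow> side \<Rightarrow> real" where
  "norms X P w i = space_norm X (sub P i) (w i)"

definition dist_sq ::
  "space \<Rightarrow> 'd::finite interface_problem \<Rightarrow> (side \<Rightarrow> real ^ 'd \<Rightarrow> real) \<Rightarrow> (side \<Rightarrow> real ^ 'd \<Rightarrow> real) \<Rightarrow> real"
  where
  "dist_sq X P u v =
     (\<Sum>i\<in>{Side1, Side2}. (space_norm X (sub P i) (\<lambda>x. u i x - v i x))\<^sup>2)"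

definition finite_differences ::
  "space \<Rightarrow> 'd::finite interface_problem \<Rightarrow> (side \<Rightarrow> real ^ 'd \<Rightarrow> real) \<Rightarrow> (side \<Rightarrow> real ^ 'd \<Rightarrow> real) \<Rightarrow> bool"
  where
  "finite_differences X P u v \<longleftrightarrow>
     (\<forall>i. L2_fun (lebesgue_on (sub P i)) (\<lambda>x. div_grad X (sub P i) (coef P i) (u i) x
                                              - div_grad X (sub P i) (coef P i) (v i) x)) \<and>
     (\<forall>i. L2_fun (surface_on (outer_boundary P i))
            (\<lambda>x. bd_value X (sub P i) (u i) x - bd_value X (sub P i) (v i) x)) \<and>
     L2_fun (surface_on (intf P)) (\<lambda>x. jump X P u x - jump X P v x) \<and>
     L2_fun (surface_on (intf P)) (\<lambda>x. flux_jump X P u x - flux_jump X P v x)"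

text \<open>
  \<open>V\<close> is the class of the sufficiently regular pairs; it may be all of the space, as far as the
  \<open>L\<^sup>2\<close> norms in the estimate are finite.  \<open>Cpde\<close> is a function of the norms of \<open>u\<^sub>i\<close> and of
  \<open>v\<^sub>i\<close>; it may depend on the coefficient, the domains and the space because these are fixed
  here.  The definition makes the differences square integrable for pairs in \<open>V\<close>, so that
  \<^const>\<open>L2_norm\<close> never stands for an infinite norm.
\<close>

definition conditional_stability ::
  "space \<Rightarrow> 'd::finite interface_problem \<Rightarrow> (side \<Rightarrow> real ^ 'd \<Rightarrow> real) \<Rightarrow>
   (side \<Rightarrow> real ^ 'd \<Rightarrow> real) set \<Rightarrow> exponents \<Rightarrow>
   ((side \<Rightarrow> real) \<Rightarrow> (side \<Rightarrow> real) \<Rightarrow> real) \<Rightarrow> bool" where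
  "conditional_stability X P u V e Cpde \<longleftrightarrow>
     valid_exponents e \<and>
     (\<forall>v\<in>V. (\<forall>i. in_space X (sub P i) (v i)) \<and> finite_differences X P u v \<and>
        0 < Cpde (norms X P u) (norms X P v) \<and>
        dist_sq X P u v \<le> Cpde (norms X P u) (norms X P v) * (
          (\<Sum>i\<in>{Side1, Side2}.
             ((L2_norm (lebesgue_on (sub P i))
                 (\<lambda>x. div_grad X (sub P i) (coef P i) (u i) x
                    - div_grad X (sub P i) (coef P i) (v i) x))\<^sup>2) powr ex_L e i +
             ((L2_norm (surface_on (outer_boundary P i))
                 (\<lambda>x. bd_value X (sub P i) (u i) x
                    - bd_value X (sub P i) (v i) x))\<^sup>2) powr ex_B e i) +
          ((L2_norm (surface_on (intf P)) (\<lambda>x. jump X P u x - jump X P v x))\<^sup>2) powr ex_G e +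
          ((L2_norm (surface_on (intf P))
              (\<lambda>x. flux_jump X P u x - flux_jump X P v x))\<^sup>2) powr ex_G e))"


section \<open>Feed-forward networks\<close>

text \<open>
  A hidden layer is given by its width and its activation function.  The parameter vector lists,
  layer by layer and neuron by neuron, the weights followed by the bias; the output layer is
  a single affine neuron.
\<close>

type_synonym architecture = "(nat \<times> (real \<Rightarrow> real)) list"

definition neuron :: "nat \<Rightarrow> real list \<Rightarrow> (nat \<Rightarrow> real) \<Rightarrow> nat \<Rightarrow> real" where
  "neuron n \<theta> z j = (\<Sum>k<n. \<theta> ! (j * (n + 1) + k) * z k) + \<theta> ! (j * (n + 1) + n)"

fun num_params :: "architecture \<Rightarrow> nat \<Rightarrow> nat" where
  "num_params [] n = n + 1"
| "num_params ((m, act) # ls) n = m * (n + 1) + num_params ls m"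

fun feed_forward :: "architecture \<Rightarrow> nat \<Rightarrow> real list \<Rightarrow> (nat \<Rightarrow> real) \<Rightarrow> real" where
  "feed_forward [] n \<theta> z = neuron n \<theta> z 0"
| "feed_forward ((m, act) # ls) n \<theta> z =
     feed_forward ls m (drop (m * (n + 1)) \<theta>) (\<lambda>j. act (neuron n \<theta> z j))"

definition coord :: "nat \<Rightarrow> 'd::finite" where
  "coord = (SOME c. bij_betw c {..<CARD('d)} UNIV)"

definition network :: "architecture \<Rightarrow> real list \<Rightarrow> real ^ 'd \<Rightarrow> real" where
  "network arch \<theta> x = feed_forward arch CARD('d) \<theta> (\<lambda>k. x $ coord k)"

definition networks :: "architecture \<Rightarrow> (side \<Rightarrow> real list) \<Rightarrow> side \<Rightarrow> real ^ 'd \<Rightarrow> real" where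
  "networks arch \<theta> i = network arch (\<theta> i)"


section \<open>Discrete losses and quadrature errors\<close>

record 'd samples =
  pts_L :: "side \<Rightarrow> (real ^ 'd) list"
  pts_B :: "side \<Rightarrow> (real ^ 'd) list"
  pts_G :: "(real ^ 'd) list"

definition valid_samples :: "'d::finite interface_problem \<Rightarrow> 'd::finite samples \<Rightarrow> bool" where
  "valid_samples P S \<longleftrightarrow>
     (\<forall>i. set (pts_L S i) \<subseteq> sub P i) \<and> (\<forall>i. set (pts_B S i) \<subseteq> outer_boundary P i) \<and>
     set (pts_G S) \<subseteq> intf P"

datatype loss_term = Loss_L side | Loss_B side | Loss_I1 | Loss_I2

fun num_points :: "'d::finite samples \<Rightarrow> loss_term \<Rightarrow> nat" where
  "num_points S (Loss_L i) = length (pts_L S i)"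
| "num_points S (Loss_B i) = length (pts_B S i)"
| "num_points S Loss_I1 = length (pts_G S)"
| "num_points S Loss_I2 = length (pts_G S)"

text \<open>For an empty list the mean is \<open>0\<close>, that is, the term is dropped.\<close>

definition mean_sq :: "'a list \<Rightarrow> ('a \<Rightarrow> real) \<Rightarrow> real" where
  "mean_sq xs r = 1 / real (length xs) * (\<Sum>x\<leftarrow>xs. (r x)\<^sup>2)"

text \<open>The losses evaluate the classical derivatives of the networks pointwise, whatever the
  space, whereas the residuals below are those of elements of the space.\<close>

fun loss ::
  "'d::finite interface_problem \<Rightarrow> 'd::finite samples \<Rightarrow> (side \<Rightarrow> real ^ 'd \<Rightarrow> real) \<Rightarrow> loss_term \<Rightarrow> real" where
  "loss P S v (Loss_L i) = mean_sq (pts_L S i)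
     (\<lambda>x. - divergence (\<lambda>y. coef P i *\<^sub>R grad (v i) y) x - src P x)"
| "loss P S v (Loss_B i) = mean_sq (pts_B S i) (\<lambda>x. v i x - dir P x)"
| "loss P S v Loss_I1 = mean_sq (pts_G S) (\<lambda>x. v Side1 x - v Side2 x - jmp1 P x)"
| "loss P S v Loss_I2 = mean_sq (pts_G S)
     (\<lambda>x. coef P Side1 * (grad_ext (sub P Side1) (v Side1) x \<bullet> nrm P x)
        - coef P Side2 * (grad_ext (sub P Side2) (v Side2) x \<bullet> nrm P x) - jmp2 P x)"

fun residual_integral ::
  "space \<Rightarrow> 'd::finite interface_problem \<Rightarrow> (side \<Rightarrow> real ^ 'd \<Rightarrow> real) \<Rightarrow> loss_term \<Rightarrow> real" where
  "residual_integral X P v (Loss_L i) =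
     (LINT x|lebesgue_on (sub P i). (- div_grad X (sub P i) (coef P i) (v i) x - src P x)\<^sup>2)"
| "residual_integral X P v (Loss_B i) =
     (LINT x|surface_on (outer_boundary P i). (bd_value X (sub P i) (v i) x - dir P x)\<^sup>2)"
| "residual_integral X P v Loss_I1 =
     (LINT x|surface_on (intf P). (jump X P v x - jmp1 P x)\<^sup>2)"
| "residual_integral X P v Loss_I2 =
     (LINT x|surface_on (intf P). (flux_jump X P v x - jmp2 P x)\<^sup>2)"

text \<open>\<open>N\<^sup>-\<^sup>a\<close>, dropped for \<open>N = 0\<close>.  In this case the quadrature bound says that the squared
  residual has integral \<open>0\<close>, as it has over an empty set.\<close>

definition decay :: "nat \<Rightarrow> real \<Rightarrow> real" where
  "decay N a = (if N = 0 then 0 else real N powr (- a))"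

definition quadrature_error ::
  "space \<Rightarrow> 'd::finite interface_problem \<Rightarrow> 'd::finite samples \<Rightarrow> (side \<Rightarrow> real ^ 'd \<Rightarrow> real) \<Rightarrow>
   (loss_term \<Rightarrow> real) \<Rightarrow> (loss_term \<Rightarrow> real) \<Rightarrow> bool" where
  "quadrature_error X P S v Ct rate \<longleftrightarrow>
     (\<forall>t. 0 < Ct t \<and> 0 < rate t \<and>
        \<bar>residual_integral X P v t - loss P S v t\<bar> \<le> Ct t * decay (num_points S t) (rate t))"

definition total_loss ::
  "'d::finite interface_problem \<Rightarrow> 'd::finite samples \<Rightarrow> (loss_term \<Rightarrow> real) \<Rightarrow> (side \<Rightarrow> real ^ 'd \<Rightarrow> real) \<Rightarrow> real"
  where
  "total_loss P S wt v =
     (\<Sum>i\<in>{Side1, Side2}.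
        wt (Loss_L i) * loss P S v (Loss_L i) + wt (Loss_B i) * loss P S v (Loss_B i)) +
     wt Loss_I1 * loss P S v Loss_I1 + wt Loss_I2 * loss P S v Loss_I2"

text \<open>The competitors are the parameters whose networks lie in the space (for smooth
  activation functions, all of them).\<close>

definition trained ::
  "space \<Rightarrow> 'd::finite interface_problem \<Rightarrow> 'd::finite samples \<Rightarrow> architecture \<Rightarrow> (side \<Rightarrow> real list) \<Rightarrow> bool" where
  "trained X P S arch \<theta> \<longleftrightarrow>
     (let admissible = (\<lambda>\<theta>. \<forall>i. length (\<theta> i) = num_params arch CARD('d) \<and>
                               in_space X (sub P i) (networks arch \<theta> i))
      in admissible \<theta> \<and>
         (\<exists>wt. (\<forall>t. 0 < wt t) \<and>
            (\<forall>\<theta>'. admissible \<theta>' \<longrightarrow>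
               total_loss P S wt (networks arch \<theta>) \<le> total_loss P S wt (networks arch \<theta>'))))"

end

theory Submission
  imports Defs
begin

text \<open>
  The solution \<open>u\<close> satisfies the four equations of the problem almost everywhere.  Hence each
  difference between \<open>u\<close> and a competitor \<open>v\<close> that stability measures, such as
  \<open>\<nabla> \<cdot> (\<beta>\<nabla>u) - \<nabla> \<cdot> (\<beta>\<nabla>v)\<close> or \<open>\<lbrakk>u\<rbrakk> - \<lbrakk>v\<rbrakk>\<close>, is up to sign and a null set the residual
  of \<open>v\<close>, and its squared \<open>L\<^sup>2\<close> norm is the integral of the squared residual
  (\<open>stability_norms_are_residual_integrals\<close>).  This integral exceeds the discrete loss by at
  most the quadrature error.  As the stability exponents lie in \<open>(0, 1]\<close>, the map
  \<open>t \<mapsto> t\<^sup>p\<close> is increasing and subadditive on \<open>t \<ge> 0\<close>, so that the \<open>p\<close>-th power of the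
  integral is at most the \<open>p\<close>-th power of the loss plus \<open>(c N\<^sup>-\<^sup>a)\<^sup>p = c\<^sup>p N\<^sup>-\<^sup>a\<^sup>p\<close>, where
  \<open>c\<close> and \<open>a\<close> are the constant and the rate of the quadrature
  (\<open>residual_integral_powr_le\<close>).  The quadrature constant of the theorem is therefore \<open>c\<^sup>p\<close>.
  Inserting these bounds into the stability estimate, one term at a time, gives the theorem.

  The first step has a measure-theoretic side: a function that agrees almost everywhere
  with an integrable one has the same integral if it is measurable, and the residuals contain data of which
  measurability on the piece in question is not known beforehand.  The differences in the
  stability estimate are square integrable, hence measurable, and the measures on the pieces
  are complete, so measurability passes to the residuals.
\<close>

section \<open>Square integrals of functions that agree almost everywhere\<close>

lemma complete_measure_restrict_space:
  assumes "complete_measure M" "A \<in> sets M"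
  shows "complete_measure (restrict_space M A)"
proof
  fix B N
  assume "B \<subseteq> N" "N \<in> null_sets (restrict_space M A)"
  then have "B \<subseteq> A" "N \<in> null_sets M" "B \<subseteq> N"
    using assms(2) by (auto simp: null_sets_restrict_space)
  then show "B \<in> sets (restrict_space M A)"
    using complete_measure.complete2[OF assms(1)] assms(2)
    by (metis null_setsD2 null_sets_restrict_space)
qed

text \<open>
  Preimages of an open set under the two functions differ by a subset of a null set.
\<close>

lemma complete_measure_measurable_AE:
  fixes f g :: "'a \<Rightarrow> real"
  assumes "complete_measure M" "f \<in> borel_measurable M" "AE x in M. f x = g x"
  shows "g \<in> borel_measurable M"
proof (rule borel_measurableI)
  fix S :: "real set"
  assume "open S"
  then have S: "f -` S \<inter> space M \<in> sets M"
    using assms(2) by (auto intro: measurable_sets)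
  have "(AE x in M. x \<in> f -` S \<inter> space M \<longleftrightarrow> x \<in> g -` S \<inter> space M)"
    using assms(3) by eventually_elim auto
  then show "g -` S \<inter> space M \<in> sets M"
    by (rule complete_measure.in_sets_AE[OF assms(1) _ S]) auto
qed

text \<open>
  The sign is left open because the equation in the interior contains \<open>- div_grad\<close>, so that
  the difference is the residual itself there, but its negative in the other three conditions.
\<close>

lemma L2_norm_sq_eq_residual_integral:
  assumes "complete_measure M" "L2_fun M h" "AE x in M. h x = r x \<or> h x = - r x"
  shows "(L2_norm M h)\<^sup>2 = (LINT x|M. (r x)\<^sup>2)"
proof -
  have sq: "AE x in M. (h x)\<^sup>2 = (r x)\<^sup>2"
    using assms(3) by eventually_elim auto
  have h: "(\<lambda>x. (h x)\<^sup>2) \<in> borel_measurable M"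
    using assms(2) by (auto simp: L2_fun_def)
  have "(L2_norm M h)\<^sup>2 = (LINT x|M. (h x)\<^sup>2)"
    by (simp add: L2_norm_def)
  also have "\<dots> = (LINT x|M. (r x)\<^sup>2)"
    using h complete_measure_measurable_AE[OF assms(1) h sq] sq by (rule integral_cong_AE)
  finally show ?thesis .
qed

section \<open>Completeness of the measures on the pieces of the domain\<close>

lemma complete_lebesgue_on:
  assumes "A \<in> sets lebesgue"
  shows "complete_measure (lebesgue_on A)"
  using completion.complete_measure_axioms assms by (rule complete_measure_restrict_space)

text \<open>
  The \<open>\<sigma>\<close>-algebra of \<^const>\<open>measure_of\<close> depends only on the generating sets, not on the
  set function; here they are the Borel sets.
\<close>

lemma borel_imp_surface_set:
  fixes A :: "(real ^ 'd) set"
  assumes "A \<in> sets borel"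
  shows "A \<in> sets surface"
proof -
  have "A \<in> sets (measure_of UNIV (sets borel) (hausdorff_outer (real CARD('d) - 1)))"
    using assms by (subst sets_measure_of) (auto)
  then show ?thesis
    unfolding surface_def by (rule sets_completionI_sets)
qed

lemma complete_surface_on:
  fixes A :: "(real ^ 'd) set"
  assumes "A \<in> sets borel"
  shows "complete_measure (surface_on A)"
proof (rule complete_measure_restrict_space)
  show "complete_measure (surface :: (real ^ 'd) measure)"
    unfolding surface_def by (rule completion.complete_measure_axioms)
  show "A \<in> sets surface"
    using assms by (rule borel_imp_surface_set)
qed

lemma setting_borel_sets:
  assumes "setting P"
  shows "sub P i \<in> sets borel" "intf P \<in> sets borel" "outer_boundary P i \<in> sets borel"
proof -
  have o: "open (dom P)" "open (sub P Side1 \<union> sub P Side2)" "open (sub P i)"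
    using assms by (auto simp: setting_def)
  have "intf P = dom P - (sub P Side1 \<union> sub P Side2)"
    using assms by (auto simp: setting_def)
  then show "intf P \<in> sets borel"
    using o(1,2) by simp
  then show "outer_boundary P i \<in> sets borel"
    by (intro sets.Diff) auto
  show "sub P i \<in> sets borel"
    using o(3) by (rule borel_open)
qed

text \<open>
  A boundary point of one subdomain inside the domain is on the interface, since it cannot lie
  in the other subdomain, which is open and disjoint from the first.  This is what makes the
  Dirichlet condition, imposed on the boundary of the domain, available on the outer boundary.
\<close>

lemma outer_boundary_subset:
  assumes "setting P"
  shows "outer_boundary P i \<subseteq> frontier (dom P) \<inter> frontier (sub P i)"
proof
  fix x
  assume x: "x \<in> outer_boundary P i"
  have o: "open (dom P)" "\<And>j. open (sub P j)"
    and disj: "sub P Side1 \<inter> sub P Side2 = {}"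
    and part: "dom P - intf P = sub P Side1 \<union> sub P Side2"
    using assms by (auto simp: setting_def)
  have sub: "sub P i \<subseteq> dom P"
    using part by (cases i) auto
  have xc: "x \<in> closure (sub P i)" "x \<notin> sub P i"
    using x o(2)[of i] by (auto simp: frontier_def interior_open)
  have "x \<notin> sub P j" for j
  proof
    assume xj: "x \<in> sub P j"
    then have "sub P j \<inter> sub P i \<noteq> {}"
      using open_Int_closure_eq_empty[OF o(2)] xc by blast
    then show False
      using disj xj xc(2) by (cases i; cases j) auto
  qed
  then have "x \<notin> dom P"
    using part x by auto
  then show "x \<in> frontier (dom P) \<inter> frontier (sub P i)"
    using x closure_mono[OF sub] xc o(1) by (auto simp: frontier_def interior_open)
qed

lemma AE_surface_on_subset:
  assumes "A \<subseteq> B" "A \<in> sets borel" "B \<in> sets borel" "AE x in surface_on B. Q x"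
  shows "AE x in surface_on A. Q x"
proof -
  have "AE x in surface. x \<in> B \<longrightarrow> Q x"
    using assms(3,4) AE_restrict_space_iff[of B surface Q] borel_imp_surface_set by auto
  then have "AE x in surface. x \<in> A \<longrightarrow> Q x"
    by eventually_elim (use assms(1) in auto)
  then show ?thesis
    using assms(2) AE_restrict_space_iff[of A surface Q] borel_imp_surface_set by auto
qed

section \<open>Stability norms and residuals\<close>

text \<open>
  On each piece the corresponding equation for \<open>u\<close> replaces the contribution of \<open>u\<close> to the
  difference by the data.
\<close>

lemma stability_norms_are_residual_integrals:
  assumes P: "setting P" and u: "is_solution X P u" and fin: "finite_differences X P u v"
  shows "(L2_norm (lebesgue_on (sub P i)) (\<lambda>x. div_grad X (sub P i) (coef P i) (u i) x
             - div_grad X (sub P i) (coef P i) (v i) x))\<^sup>2 = residual_integral X P v (Loss_L i)"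
    and "(L2_norm (surface_on (outer_boundary P i)) (\<lambda>x. bd_value X (sub P i) (u i) x
             - bd_value X (sub P i) (v i) x))\<^sup>2 = residual_integral X P v (Loss_B i)"
    and "(L2_norm (surface_on (intf P)) (\<lambda>x. jump X P u x - jump X P v x))\<^sup>2
           = residual_integral X P v Loss_I1"
    and "(L2_norm (surface_on (intf P)) (\<lambda>x. flux_jump X P u x - flux_jump X P v x))\<^sup>2
           = residual_integral X P v Loss_I2"
proof -
  note borel = setting_borel_sets[OF P]
  have "AE x in lebesgue_on (sub P i). - div_grad X (sub P i) (coef P i) (u i) x = src P x"
    using u by (auto simp: is_solution_def)
  then have "AE x in lebesgue_on (sub P i).
      div_grad X (sub P i) (coef P i) (u i) x - div_grad X (sub P i) (coef P i) (v i) x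
        = - div_grad X (sub P i) (coef P i) (v i) x - src P x \<or>
      div_grad X (sub P i) (coef P i) (u i) x - div_grad X (sub P i) (coef P i) (v i) x
        = - (- div_grad X (sub P i) (coef P i) (v i) x - src P x)"
    by eventually_elim auto
  then show "(L2_norm (lebesgue_on (sub P i)) (\<lambda>x. div_grad X (sub P i) (coef P i) (u i) x
             - div_grad X (sub P i) (coef P i) (v i) x))\<^sup>2 = residual_integral X P v (Loss_L i)"
    using fin complete_lebesgue_on[of "sub P i"] borel(1)[of i]
    by (simp add: finite_differences_def L2_norm_sq_eq_residual_integral)
next
  note borel = setting_borel_sets[OF P]
  have "AE x in surface_on (frontier (dom P) \<inter> frontier (sub P i)).
      bd_value X (sub P i) (u i) x = dir P x"
    using u by (auto simp: is_solution_def)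
  then have "AE x in surface_on (outer_boundary P i). bd_value X (sub P i) (u i) x = dir P x"
    by (intro AE_surface_on_subset[OF outer_boundary_subset[OF P] borel(3)])
       (auto intro!: borel_closed)
  then have "AE x in surface_on (outer_boundary P i).
      bd_value X (sub P i) (u i) x - bd_value X (sub P i) (v i) x
        = bd_value X (sub P i) (v i) x - dir P x \<or>
      bd_value X (sub P i) (u i) x - bd_value X (sub P i) (v i) x
        = - (bd_value X (sub P i) (v i) x - dir P x)"
    by eventually_elim auto
  then show "(L2_norm (surface_on (outer_boundary P i)) (\<lambda>x. bd_value X (sub P i) (u i) x
             - bd_value X (sub P i) (v i) x))\<^sup>2 = residual_integral X P v (Loss_B i)"
    using fin complete_surface_on[OF borel(3)]
    by (simp add: finite_differences_def L2_norm_sq_eq_residual_integral)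
next
  note complete = complete_surface_on[OF setting_borel_sets(2)[OF P]]
  have "AE x in surface_on (intf P). jump X P u x = jmp1 P x"
    using u by (auto simp: is_solution_def)
  then have "AE x in surface_on (intf P). jump X P u x - jump X P v x = jump X P v x - jmp1 P x \<or>
      jump X P u x - jump X P v x = - (jump X P v x - jmp1 P x)"
    by eventually_elim auto
  then show "(L2_norm (surface_on (intf P)) (\<lambda>x. jump X P u x - jump X P v x))\<^sup>2
           = residual_integral X P v Loss_I1"
    using fin complete by (simp add: finite_differences_def L2_norm_sq_eq_residual_integral)
  have "AE x in surface_on (intf P). flux_jump X P u x = jmp2 P x"
    using u by (auto simp: is_solution_def)
  then have "AE x in surface_on (intf P).
      flux_jump X P u x - flux_jump X P v x = flux_jump X P v x - jmp2 P x \<or>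
      flux_jump X P u x - flux_jump X P v x = - (flux_jump X P v x - jmp2 P x)"
    by eventually_elim auto
  then show "(L2_norm (surface_on (intf P)) (\<lambda>x. flux_jump X P u x - flux_jump X P v x))\<^sup>2
           = residual_integral X P v Loss_I2"
    using fin complete by (simp add: finite_differences_def L2_norm_sq_eq_residual_integral)
qed

section \<open>Powers of the quadrature bound\<close>

text \<open>
  For \<open>s = a + b > 0\<close> the fractions \<open>a/s\<close> and \<open>b/s\<close> lie in \<open>[0, 1]\<close>, where \<open>t \<le> t\<^sup>p\<close>;
  adding the two instances of this inequality gives \<open>1 \<le> (a\<^sup>p + b\<^sup>p) / s\<^sup>p\<close>.
\<close>

lemma powr_subadditive:
  fixes a b p :: real
  assumes "0 \<le> a" "0 \<le> b" "0 < p" "p \<le> 1"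
  shows "(a + b) powr p \<le> a powr p + b powr p"
proof (cases "a + b = 0")
  case True
  then have "a = 0" "b = 0" using assms(1,2) by linarith+
  then show ?thesis by simp
next
  case False
  define s where "s = a + b"
  have s: "0 < s" using False assms by (auto simp: s_def)
  have frac_le: "t / s * s powr p \<le> t powr p" if t: "0 \<le> t" "t \<le> s" for t
  proof -
    have "t / s \<le> (t / s) powr p"
      using powr_mono'[of p 1 "t / s"] t s assms by (auto)
    then have "t / s * s powr p \<le> (t / s) powr p * s powr p"
      by (rule mult_right_mono) auto
    also have "\<dots> = t powr p"
      using t s by (simp add: powr_divide)
    finally show ?thesis .
  qed
  have "a / s + b / s = 1"
    using s unfolding s_def by (metis add_divide_distrib divide_self less_irrefl)
  then have "s powr p = a / s * s powr p + b / s * s powr p"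
    by (metis distrib_right mult_1)
  also have "\<dots> \<le> a powr p + b powr p"
    using assms by (intro add_mono frac_le) (auto simp: s_def)
  finally show ?thesis by (simp add: s_def)
qed

lemma decay_nonneg: "0 \<le> decay N a"
  by (auto simp: decay_def)

lemma decay_powr:
  assumes "0 < p"
  shows "decay N a powr p = decay N (a * p)"
  using assms by (auto simp: decay_def powr_powr)

lemma loss_nonneg: "0 \<le> loss P S v t"
proof -
  have "0 \<le> mean_sq xs r" for xs :: "(real^'d) list" and r
    by (auto simp: mean_sq_def intro!: divide_nonneg_nonneg sum_list_nonneg)
  then show ?thesis by (cases t) auto
qed

lemma residual_integral_nonneg: "0 \<le> residual_integral X P v t"
  by (cases t) auto

lemma residual_integral_powr_le:
  assumes quad: "quadrature_error X P S v Ct \<alpha>" and p: "0 < p" "p \<le> 1"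
  shows "residual_integral X P v t powr p
    \<le> loss P S v t powr p + Ct t powr p * decay (num_points S t) (\<alpha> t * p)"
proof -
  have Ct: "0 < Ct t"
    and err: "\<bar>residual_integral X P v t - loss P S v t\<bar> \<le> Ct t * decay (num_points S t) (\<alpha> t)"
    using quad by (auto simp: quadrature_error_def)
  have "residual_integral X P v t powr p
      \<le> (loss P S v t + Ct t * decay (num_points S t) (\<alpha> t)) powr p"
    using err p by (intro powr_mono2 residual_integral_nonneg) auto
  also have "\<dots> \<le> loss P S v t powr p + (Ct t * decay (num_points S t) (\<alpha> t)) powr p"
    using p Ct by (intro powr_subadditive loss_nonneg mult_nonneg_nonneg decay_nonneg) auto
  also have "(Ct t * decay (num_points S t) (\<alpha> t)) powr p
      = Ct t powr p * decay (num_points S t) (\<alpha> t * p)"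
    using Ct p by (simp add: powr_mult decay_nonneg decay_powr)
  finally show ?thesis .
qed

section \<open>The error estimate\<close>

fun stability_exponent :: "loss_term \<Rightarrow> exponents \<Rightarrow> real" where
  "stability_exponent (Loss_L i) e = ex_L e i"
| "stability_exponent (Loss_B i) e = ex_B e i"
| "stability_exponent Loss_I1 e = ex_G e"
| "stability_exponent Loss_I2 e = ex_G e"

theorem theorem4p1:
  shows "\<exists>Cquad :: loss_term \<Rightarrow> real \<Rightarrow> exponents \<Rightarrow> real.
    (\<forall>t c e. 0 < c \<and> valid_exponents e \<longrightarrow> 0 < Cquad t c e) \<and>
    (\<forall>X (P :: 'd::finite interface_problem) u V e Cpde S arch \<theta> Ct \<alpha>.
       admissible_space X \<and> setting P \<and> is_solution X P u \<and>
       valid_samples P S \<and> trained X P S arch \<theta> \<and>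
       conditional_stability X P u V e Cpde \<and> networks arch \<theta> \<in> V \<and>
       quadrature_error X P S (networks arch \<theta>) Ct \<alpha> \<longrightarrow>
       dist_sq X P u (networks arch \<theta>) \<le>
         Cpde (norms X P u) (norms X P (networks arch \<theta>)) * (
           (\<Sum>i\<in>{Side1, Side2}.
              loss P S (networks arch \<theta>) (Loss_L i) powr ex_L e i +
              loss P S (networks arch \<theta>) (Loss_B i) powr ex_B e i) +
           loss P S (networks arch \<theta>) Loss_I1 powr ex_G e +
           loss P S (networks arch \<theta>) Loss_I2 powr ex_G e +
           (\<Sum>i\<in>{Side1, Side2}.
              Cquad (Loss_L i) (Ct (Loss_L i)) e * decay (length (pts_L S i)) (\<alpha> (Loss_L i) * ex_L e i) +
              Cquad (Loss_B i) (Ct (Loss_B i)) e * decay (length (pts_B S i)) (\<alpha> (Loss_B i) * ex_B e i)) +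
           Cquad Loss_I1 (Ct Loss_I1) e * decay (length (pts_G S)) (\<alpha> Loss_I1 * ex_G e) +
           Cquad Loss_I2 (Ct Loss_I2) e * decay (length (pts_G S)) (\<alpha> Loss_I2 * ex_G e)))"
proof (intro exI[of _ "\<lambda>t c e. c powr stability_exponent t e"] conjI allI impI)
  fix t e and c :: real
  assume "0 < c \<and> valid_exponents e"
  then show "0 < c powr stability_exponent t e" by simp
next
  fix X and P :: "'d interface_problem" and u V e Cpde S arch \<theta> Ct \<alpha>
  assume asm: "admissible_space X \<and> setting P \<and> is_solution X P u \<and>
       valid_samples P S \<and> trained X P S arch \<theta> \<and>
       conditional_stability X P u V e Cpde \<and> networks arch \<theta> \<in> V \<and>
       quadrature_error X P S (networks arch \<theta>) Ct \<alpha>"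
  define v :: "side \<Rightarrow> real^'d \<Rightarrow> real" where "v = networks arch \<theta>"
  define C where "C = Cpde (norms X P u) (norms X P v)"
  have P: "setting P" and u: "is_solution X P u" and quad: "quadrature_error X P S v Ct \<alpha>"
    and stab: "conditional_stability X P u V e Cpde" and v: "v \<in> V"
    using asm by (auto simp: v_def)
  have fin: "finite_differences X P u v" and C: "0 < C" and e: "valid_exponents e"
    using stab v by (auto simp: conditional_stability_def C_def)
  let ?R = "\<lambda>t. residual_integral X P v t powr stability_exponent t e"
  let ?B = "\<lambda>t. loss P S v t powr stability_exponent t e
      + Ct t powr stability_exponent t e * decay (num_points S t) (\<alpha> t * stability_exponent t e)"
  have "0 < stability_exponent t e \<and> stability_exponent t e \<le> 1" for t
    using e by (cases t) (auto simp: valid_exponents_def)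
  then have R_le: "?R t \<le> ?B t" for t
    using residual_integral_powr_le[OF quad] by blast
  have "dist_sq X P u v \<le> C * ((\<Sum>i\<in>{Side1, Side2}. ?R (Loss_L i) + ?R (Loss_B i))
      + ?R Loss_I1 + ?R Loss_I2)"
    using bspec[OF conjunct2[OF stab[unfolded conditional_stability_def]] v]
    unfolding C_def stability_norms_are_residual_integrals[OF P u fin] stability_exponent.simps
    by (elim conjE)
  also have "\<dots> \<le> C * ((\<Sum>i\<in>{Side1, Side2}. ?B (Loss_L i) + ?B (Loss_B i))
      + ?B Loss_I1 + ?B Loss_I2)"
    using C by (intro mult_left_mono add_mono sum_mono R_le) auto
  finally show "dist_sq X P u (networks arch \<theta>) \<le>
         Cpde (norms X P u) (norms X P (networks arch \<theta>)) * (
           (\<Sum>i\<in>{Side1, Side2}.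
              loss P S (networks arch \<theta>) (Loss_L i) powr ex_L e i +
              loss P S (networks arch \<theta>) (Loss_B i) powr ex_B e i) +
           loss P S (networks arch \<theta>) Loss_I1 powr ex_G e +
           loss P S (networks arch \<theta>) Loss_I2 powr ex_G e +
           (\<Sum>i\<in>{Side1, Side2}.
              Ct (Loss_L i) powr stability_exponent (Loss_L i) e
                * decay (length (pts_L S i)) (\<alpha> (Loss_L i) * ex_L e i) +
              Ct (Loss_B i) powr stability_exponent (Loss_B i) e
                * decay (length (pts_B S i)) (\<alpha> (Loss_B i) * ex_B e i)) +
           Ct Loss_I1 powr stability_exponent Loss_I1 e
             * decay (length (pts_G S)) (\<alpha> Loss_I1 * ex_G e) +
           Ct Loss_I2 powr stability_exponent Loss_I2 e
             * decay (length (pts_G S)) (\<alpha> Loss_I2 * ex_G e))"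
    unfolding C_def v_def stability_exponent.simps num_points.simps sum.distrib
    by (simp only: add.assoc add.commute add.left_commute)
qed

end
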